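(* Fix $\kappa\in(0,1)$. Let $f$ be a real strongly additive function satisfying $$\sum_{p}\frac{\min(1,f(p)^2)}{p}<\infty,\qquad \sum_{p:\,|f(p)|\leqslant 1}\frac{f(p)}{p}\ \text{ converges},\qquad \sum_{p:\,f(p)\neq 0}\frac1p=\infty,$$ and let $\eta_f$ be a tail function for $f$. Let $h$ be a function from the positive integers to the non-negative integers, with fibres $\mathcal F(x;k)=\{n\leqslant x:\ h(n)=k\}$ and $N_k(x)=\#\mathcal F(x;k)$. Assume that $(\mathcal F(x;k))$ is an admissible fibre, and assume the following ratio estimate: there exist constants $x_0(\kappa)\geqslant 3$ and $C(\kappa)>0$ such that, for all $x\geqslant x_0(\kappa)$, all integers $k\geqslant 1$ with $\kappa\leqslant r:=k/\log_2 x\leqslant 1/\kappa$, and every integer $m$ with $2\leqslant m\leqslant x/2^{k-1}$, $$N_{k-1}\left(\frac{x}{m}\right)\leqslant C(\kappa)\,\frac{r}{m}\,N_k(x).$$ Then there exists a constant $C_\kappa>0$ such that, uniformly for all real $x\geqslant 3$, all integers $k\geqslant 1$ with $\kappa\leqslant r:=k/\log_2 x\leqslant 1/\kappa$, and all $R\in[3,x]$, $$\#\{n\in\mathcal F(x;k):\ f_R(n)\neq f(n)\}\leqslant C_\kappa\, r\,\eta_f(R)\,N_k(x).$$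
   Context: Sums indexed by $p$ are over primes, taken in increasing order when only conditionally convergent; $\log_2 x:=\log\log x$. A real function $f$ on the positive integers is strongly additive if $f(mn)=f(m)+f(n)$ whenever $(m,n)=1$ and $f(p^\nu)=f(p)$ for all primes $p$ and $\nu\geqslant 1$. Tail function: a function $\eta_f$ that is continuous, non-increasing, tends to $0$ as $y\to\infty$, and satisfies, for every $y>1$, $$\Bigl|\sum_{p>y,\ |f(p)|\leqslant 1}\frac{f(p)}{p}\Bigr|\leqslant \eta_f(y),\qquad \sum_{p^\nu>y}\frac{\min\{1,f(p)^2\}}{p^\nu}\leqslant\eta_f(y),$$ where the second sum is over prime powers $p^\nu$ ($\nu\geqslant 1$). Truncation: for $R\geqslant 3$, $f_R$ is the additive function determined on prime powers ($\nu\geqslant1$) by $f_R(p^\nu)=f(p)$ if $p\leqslant R$ or $|f(p)|\leqslant 1$, and $f_R(p^\nu)=0$ if $p>R$ and $|f(p)|>1$. Admissible fibre: for real $x>0$ and integer $k\geqslant 0$, $\mathcal F(x;k)$ is the set of positive integers $n\leqslant x$ with $h(n)=k$. The family is an admissible fibre if, for $k\geqslant 1$: (i) whenever $n\in\mathcal F(x;k)$, $p$ is a prime dividing $n$, and $n=p^\nu m$ with $(m,p)=1$, one has $m\in\mathcal F(x/p^\nu;k-1)$; and (ii) for every $k\geqslant 0$, $n\in\mathcal F(x;k)$ implies $n\geqslant 2^k$. The constant $C_\kappa$ depends only on $\kappa$ and on the constants $x_0(\kappa)$, $C(\kappa)$ of the ratio estimate. *)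

theory Defs
  imports "HOL-Analysis.Analysis" "HOL-Computational_Algebra.Computational_Algebra"
begin

(* Arithmetic functions are total on nat; their value at 0 is never used. *)

definition additive_fun :: "(nat \<Rightarrow> real) \<Rightarrow> bool" where
  "additive_fun f \<longleftrightarrow> (\<forall>m n. 0 < m \<longrightarrow> 0 < n \<longrightarrow> coprime m n \<longrightarrow> f (m * n) = f m + f n)"

definition strongly_additive :: "(nat \<Rightarrow> real) \<Rightarrow> bool" where
  "strongly_additive f \<longleftrightarrow>
     additive_fun f \<and> (\<forall>p \<nu>. prime p \<longrightarrow> 1 \<le> \<nu> \<longrightarrow> f (p ^ \<nu>) = f p)"

definition log2_iter :: "real \<Rightarrow> real" where
  "log2_iter x = ln (ln x)"

(* The terms of the sum of f(p)/p over the primes p > y with |f(p)| <= 1, as a series over nat: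
   summable and suminf then take the primes in increasing order, so conditional convergence is
   allowed (unlike with summable_on and infsum). *)
definition small_prime_term :: "(nat \<Rightarrow> real) \<Rightarrow> real \<Rightarrow> nat \<Rightarrow> real" where
  "small_prime_term f y p = (if prime p \<and> y < real p \<and> \<bar>f p\<bar> \<le> 1 then f p / real p else 0)"

(* Pairs (p, \<nu>) stand for the prime powers p^\<nu>. The conjuncts summable and summable_on
   say that the sums being bounded exist, since suminf and infsum are totalised. *)
definition tail_function :: "(nat \<Rightarrow> real) \<Rightarrow> (real \<Rightarrow> real) \<Rightarrow> bool" where
  "tail_function f \<eta> \<longleftrightarrow>
     continuous_on {1<..} \<eta> \<and>
     antimono_on {1<..} \<eta> \<and>
     (\<eta> \<longlongrightarrow> 0) at_top \<and>
     (\<forall>y>1. summable (small_prime_term f y) \<and>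
            \<bar>\<Sum>p. small_prime_term f y p\<bar> \<le> \<eta> y) \<and>
     (\<forall>y>1. (\<lambda>(p, \<nu>). min 1 ((f p)\<^sup>2) / real (p ^ \<nu>))
               summable_on {(p, \<nu>). prime p \<and> 1 \<le> \<nu> \<and> y < real (p ^ \<nu>)} \<and>
            (\<Sum>\<^sub>\<infinity>(p, \<nu>)\<in>{(p, \<nu>). prime p \<and> 1 \<le> \<nu> \<and> y < real (p ^ \<nu>)}.
               min 1 ((f p)\<^sup>2) / real (p ^ \<nu>)) \<le> \<eta> y)"

(* Explicit form of f_R; the three lemmas below show that it is the unique additive function
   with the prescribed values at prime powers. *)
definition truncation :: "real \<Rightarrow> (nat \<Rightarrow> real) \<Rightarrow> nat \<Rightarrow> real" where
  "truncation R f n =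
     (\<Sum>p\<in>prime_factors n. if real p \<le> R \<or> \<bar>f p\<bar> \<le> 1 then f p else 0)"

lemma additive_fun_truncation: "additive_fun (truncation R f)"
  unfolding additive_fun_def
proof (intro allI impI)
  fix m n :: nat
  assume mn: "0 < m" "0 < n" "coprime m n"
  have "prime_factors m \<inter> prime_factors n = {}"
    using mn(3) by (auto simp: in_prime_factors_iff dest: coprime_common_divisor_nat)
  then show "truncation R f (m * n) = truncation R f m + truncation R f n"
    using mn unfolding truncation_def by (simp add: prime_factors_product sum.union_disjoint)
qed

lemma truncation_prime_power:
  assumes "prime p" "1 \<le> \<nu>"
  shows "truncation R f (p ^ \<nu>) = (if real p \<le> R \<or> \<bar>f p\<bar> \<le> 1 then f p else 0)"
  using assms unfolding truncation_def
  by (simp add: prime_factorization_prime_power)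

lemma additive_fun_unique:
  assumes f: "additive_fun f" and g: "additive_fun g"
    and pp: "\<And>p \<nu>. prime p \<Longrightarrow> 1 \<le> \<nu> \<Longrightarrow> f (p ^ \<nu>) = g (p ^ \<nu>)"
    and n: "0 < n"
  shows "f n = g n"
  using n
proof (induction n rule: less_induct)
  case (less n)
  show ?case
  proof (cases "n = 1")
    case True
    have "f (1 * 1) = f 1 + f 1" "g (1 * 1) = g 1 + g 1"
      using f g unfolding additive_fun_def by (metis coprime_1_left zero_less_one)+
    then show ?thesis using True by simp
  next
    case False
    then obtain p where p: "prime p" "p dvd n" using prime_factor_nat by blast
    define \<nu> where "\<nu> = multiplicity p n"
    obtain m where m: "n = p ^ \<nu> * m" "\<not> p dvd m"
      using less.prems p(1) unfolding \<nu>_def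
      by (metis multiplicity_decompose' not_prime_unit not_gr_zero)
    have \<nu>: "1 \<le> \<nu>"
      using p m by (metis One_nat_def Suc_leI mult_1 not_gr_zero power_0)
    have cop: "coprime (p ^ \<nu>) m" using p(1) m(2) by (simp add: prime_imp_coprime)
    have m0: "0 < m" using less.prems m(1) by (auto intro: Nat.gr0I)
    have q: "1 < p ^ \<nu>" using one_less_power[OF prime_gt_1_nat[OF p(1)], of \<nu>] \<nu> by simp
    have "m < n" using m0 q m(1) by simp
    then have "f m = g m" using less.IH m0 by blast
    then show ?thesis
      using f g cop m0 q pp[OF p(1) \<nu>] m(1) unfolding additive_fun_def
      by (metis less_trans zero_less_one)
  qed
qed

definition fibre :: "(nat \<Rightarrow> nat) \<Rightarrow> real \<Rightarrow> nat \<Rightarrow> nat set" where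
  "fibre h x k = {n. 0 < n \<and> real n \<le> x \<and> h n = k}"

definition fibre_count :: "(nat \<Rightarrow> nat) \<Rightarrow> real \<Rightarrow> nat \<Rightarrow> nat" where
  "fibre_count h x k = card (fibre h x k)"

definition admissible_fibre :: "(nat \<Rightarrow> nat) \<Rightarrow> bool" where
  "admissible_fibre h \<longleftrightarrow>
     (\<forall>x k n p \<nu> m. 0 < x \<longrightarrow> 1 \<le> k \<longrightarrow> n \<in> fibre h x k \<longrightarrow> prime p \<longrightarrow> p dvd n \<longrightarrow>
        n = p ^ \<nu> * m \<longrightarrow> coprime m p \<longrightarrow> m \<in> fibre h (x / real (p ^ \<nu>)) (k - 1)) \<and>
     (\<forall>x k n. 0 < x \<longrightarrow> n \<in> fibre h x k \<longrightarrow> 2 ^ k \<le> n)"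

definition ratio_estimate :: "real \<Rightarrow> real \<Rightarrow> real \<Rightarrow> (nat \<Rightarrow> nat) \<Rightarrow> bool" where
  "ratio_estimate \<kappa> x0 C h \<longleftrightarrow>
     (\<forall>x k m. x0 \<le> x \<longrightarrow> 1 \<le> k \<longrightarrow>
        \<kappa> \<le> real k / log2_iter x \<longrightarrow> real k / log2_iter x \<le> 1 / \<kappa> \<longrightarrow>
        2 \<le> m \<longrightarrow> real m \<le> x / 2 ^ (k - 1) \<longrightarrow>
        real (fibre_count h (x / real m) (k - 1))
          \<le> C * ((real k / log2_iter x) / real m) * real (fibre_count h x k))"

end

theory Submission
  imports Defs
begin

text \<open>
  Call a prime \<open>p\<close> large if \<open>p > R\<close> and \<open>\<bar>f p\<bar> > 1\<close>. The truncation differs from \<open>f\<close> only by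
  dropping the values at large primes, so every exceptional \<open>n\<close> has a large prime divisor
  (\<open>truncation_neq_imp_large_prime\<close>). Splitting off its full power gives \<open>n = p^\<nu> * m\<close>, where
  admissibility puts \<open>m\<close> in the fibre of level \<open>k - 1\<close> at height \<open>x / p^\<nu>\<close>. The exceptional \<open>n\<close>
  are therefore at most as many as the sum of \<open>fibre_count h (x / p^\<nu>) (k - 1)\<close> over powers
  \<open>p^\<nu>\<close> of large primes (\<open>exceptional_count_le\<close>). The lower bound \<open>2 ^ (k - 1) \<le> m\<close> is exactly what
  places the powers that occur in the range of the ratio estimate, which turns the sum into
  \<open>C * r * fibre_count h x k\<close> times the sum of \<open>1 / p^\<nu>\<close>. As \<open>min 1 ((f p)\<^sup>2) = 1\<close> at large
  primes, that last sum is a part of the second sum defining a tail function, hence at most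
  \<open>\<eta> R\<close> (\<open>large_prime_powers_sum_le_tail\<close>).

  The ratio estimate says nothing for \<open>x < x0\<close>. There the trivial bound by the size of the whole
  fibre is enough: if an exceptional \<open>n\<close> exists, a single large prime \<open>p \<le> x\<close> already forces
  \<open>\<eta> R \<ge> 1 / p \<ge> 1 / x0\<close>, and \<open>r \<ge> \<kappa>\<close>, so the factor \<open>x0 / \<kappa>\<close> absorbs the loss.
\<close>

lemma strongly_additive_eq_sum:
  assumes "strongly_additive f" "0 < n"
  shows "f n = (\<Sum>p\<in>prime_factors n. f p)"
proof -
  define g where "g = (\<lambda>n. \<Sum>p\<in>prime_factors n. f p)"
  have "additive_fun g"
    unfolding additive_fun_def
  proof (intro allI impI)
    fix m n :: nat
    assume mn: "0 < m" "0 < n" "coprime m n"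
    have "prime_factors m \<inter> prime_factors n = {}"
      using mn(3) by (auto simp: in_prime_factors_iff dest: coprime_common_divisor_nat)
    then show "g (m * n) = g m + g n"
      using mn unfolding g_def by (simp add: prime_factors_product sum.union_disjoint)
  qed
  moreover have "f (p ^ \<nu>) = g (p ^ \<nu>)" if "prime p" "1 \<le> \<nu>" for p \<nu>
    using that assms(1) unfolding g_def strongly_additive_def
    by (simp add: prime_factorization_prime_power)
  ultimately have "f n = g n"
    using additive_fun_unique assms unfolding strongly_additive_def by blast
  then show ?thesis by (simp add: g_def)
qed

lemma truncation_neq_imp_large_prime:
  assumes "strongly_additive f" "0 < n" "truncation R f n \<noteq> f n"
  obtains p where "prime p" "p dvd n" "R < real p" "1 < \<bar>f p\<bar>"
proof -
  have "\<exists>p\<in>prime_factors n. R < real p \<and> 1 < \<bar>f p\<bar>"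
  proof (rule ccontr)
    assume "\<not> ?thesis"
    then have "truncation R f n = (\<Sum>p\<in>prime_factors n. f p)"
      unfolding truncation_def by (intro sum.cong) (auto simp: not_less)
    with strongly_additive_eq_sum[OF assms(1,2)] assms(3) show False by simp
  qed
  then show ?thesis using that by (auto simp: in_prime_factors_iff)
qed

lemma finite_fibre: "finite (fibre h x k)"
proof (rule finite_subset)
  show "fibre h x k \<subseteq> {..nat \<lfloor>x\<rfloor>}"
    unfolding fibre_def by (auto simp: le_nat_floor)
qed simp

text \<open>
  The restriction \<open>p ^ \<nu> \<le> x / 2 ^ (k - 1)\<close> is built in because it is the range of the ratio
  estimate; for an admissible fibre, larger powers contribute empty fibres of level \<open>k - 1\<close>.
\<close>

definition large_prime_powers ::
    "(nat \<Rightarrow> real) \<Rightarrow> real \<Rightarrow> real \<Rightarrow> nat \<Rightarrow> (nat \<times> nat) set" where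
  "large_prime_powers f R x k = {(p, \<nu>). prime p \<and> 1 \<le> \<nu> \<and> R < real p \<and> 1 < \<bar>f p\<bar> \<and>
     real (p ^ \<nu>) \<le> x / 2 ^ (k - 1)}"

lemma finite_large_prime_powers: "finite (large_prime_powers f R x k)"
proof (rule finite_subset)
  let ?N = "nat \<lfloor>x / 2 ^ (k - 1)\<rfloor>"
  show "large_prime_powers f R x k \<subseteq> {..?N} \<times> {..?N}"
  proof
    fix q assume "q \<in> large_prime_powers f R x k"
    then obtain p \<nu> where q: "q = (p, \<nu>)" and p: "prime p" "1 \<le> \<nu>"
      and le: "real (p ^ \<nu>) \<le> x / 2 ^ (k - 1)"
      unfolding large_prime_powers_def by blast
    have "p ^ \<nu> \<le> ?N" using le by (rule le_nat_floor)
    moreover have "p \<le> p ^ \<nu>"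
      using p prime_gt_0_nat[OF p(1)] by (intro self_le_power) auto
    moreover have "\<nu> < p ^ \<nu>" by (rule power_gt_expt) (use p prime_gt_1_nat in auto)
    ultimately show "q \<in> {..?N} \<times> {..?N}" using q by simp
  qed
qed simp

lemma large_prime_power_gt:
  assumes "(p, \<nu>) \<in> large_prime_powers f R x k"
  shows "R < real (p ^ \<nu>)"
proof -
  have p: "prime p" "1 \<le> \<nu>" "R < real p"
    using assms unfolding large_prime_powers_def by auto
  have "p \<le> p ^ \<nu>" using p prime_gt_0_nat[OF p(1)] by (intro self_le_power) auto
  with p(3) show ?thesis by (meson less_le_trans of_nat_le_iff)
qed

text \<open>
  An exceptional \<open>n\<close> is recovered from a full power \<open>p ^ \<nu>\<close> of one of its large primes and the
  cofactor, so the exceptional set is covered by injective images of fibres of level \<open>k - 1\<close>;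
  integers with several large primes are merely counted several times.
\<close>

lemma exceptional_count_le:
  assumes f: "strongly_additive f" and h: "admissible_fibre h"
    and x: "0 < x" and k: "1 \<le> k"
  shows "card {n \<in> fibre h x k. truncation R f n \<noteq> f n}
    \<le> (\<Sum>(p, \<nu>)\<in>large_prime_powers f R x k. fibre_count h (x / real (p ^ \<nu>)) (k - 1))"
proof -
  let ?B = "{n \<in> fibre h x k. truncation R f n \<noteq> f n}"
  let ?Q = "large_prime_powers f R x k"
  define A where
    "A = (\<lambda>(p, \<nu>). (\<lambda>m. p ^ \<nu> * m) ` fibre h (x / real (p ^ \<nu>)) (k - 1))"
  have "?B \<subseteq> (\<Union>q\<in>?Q. A q)"
  proof
    fix n assume "n \<in> ?B"
    then have nF: "n \<in> fibre h x k" and neq: "truncation R f n \<noteq> f n" by auto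
    then have n0: "0 < n" by (simp add: fibre_def)
    obtain p where p: "prime p" "p dvd n" "R < real p" "1 < \<bar>f p\<bar>"
      using truncation_neq_imp_large_prime[OF f n0 neq] .
    define \<nu> where "\<nu> = multiplicity p n"
    obtain m where m: "n = p ^ \<nu> * m" "\<not> p dvd m"
      using n0 p(1) unfolding \<nu>_def
      by (metis multiplicity_decompose' not_prime_unit not_gr_zero)
    have \<nu>: "1 \<le> \<nu>"
      using p m by (metis One_nat_def Suc_leI mult_1 not_gr_zero power_0)
    have pp: "0 < real (p ^ \<nu>)" using prime_gt_0_nat[OF p(1)] by simp
    have "coprime m p" using p(1) m(2) by (metis coprime_commute prime_imp_coprime)
    then have mF: "m \<in> fibre h (x / real (p ^ \<nu>)) (k - 1)"
      using h nF p(1,2) m(1) x k unfolding admissible_fibre_def by blast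
    have "0 < x / real (p ^ \<nu>)" using x pp by simp
    then have "2 ^ (k - 1) \<le> m" using h mF unfolding admissible_fibre_def by blast
    then have "real (2 ^ (k - 1)) \<le> real m" by (simp only: of_nat_le_iff)
    then have "2 ^ (k - 1) \<le> real m" by simp
    also have "real m \<le> x / real (p ^ \<nu>)" using mF by (simp add: fibre_def)
    finally have "real (p ^ \<nu>) \<le> x / 2 ^ (k - 1)" using pp by (simp add: field_simps)
    then have "(p, \<nu>) \<in> ?Q" using p \<nu> unfolding large_prime_powers_def by simp
    moreover have "n \<in> A (p, \<nu>)" using mF m(1) unfolding A_def by auto
    ultimately show "n \<in> (\<Union>q\<in>?Q. A q)" by blast
  qed
  then have "card ?B \<le> card (\<Union>q\<in>?Q. A q)"
    by (intro card_mono finite_UN_I finite_large_prime_powers)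
      (auto simp: A_def finite_fibre)
  also have "\<dots> \<le> (\<Sum>q\<in>?Q. card (A q))"
    by (rule card_UN_le[OF finite_large_prime_powers])
  also have "\<dots> \<le> (\<Sum>(p, \<nu>)\<in>?Q. fibre_count h (x / real (p ^ \<nu>)) (k - 1))"
    unfolding A_def fibre_count_def
    by (intro sum_mono) (auto intro!: card_image_le finite_fibre)
  finally show ?thesis .
qed

text \<open>
  At large primes \<open>min 1 ((f p)\<^sup>2) = 1\<close>, so this is a partial sum of a nonnegative series that
  \<open>\<eta> R\<close> bounds. The subset is arbitrary because the whole set controls the main sum, a single
  element bounds \<open>\<eta> R\<close> from below, and the empty set gives \<open>0 \<le> \<eta> R\<close>.
\<close>

lemma large_prime_powers_sum_le_tail:
  assumes \<eta>: "tail_function f \<eta>" and R: "1 < R" and S: "S \<subseteq> large_prime_powers f R x k"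
  shows "(\<Sum>(p, \<nu>)\<in>S. 1 / real (p ^ \<nu>)) \<le> \<eta> R"
proof -
  let ?g = "\<lambda>(p, \<nu>). min 1 ((f p)\<^sup>2) / real (p ^ \<nu>)"
  let ?T = "{(p, \<nu>). prime p \<and> 1 \<le> \<nu> \<and> R < real (p ^ \<nu>)}"
  have "(\<Sum>(p, \<nu>)\<in>S. 1 / real (p ^ \<nu>)) = sum ?g S"
  proof (intro sum.cong refl)
    fix q assume "q \<in> S"
    then obtain p \<nu> where q: "q = (p, \<nu>)" "1 < \<bar>f p\<bar>"
      using S unfolding large_prime_powers_def by blast
    have "1 \<le> (f p)\<^sup>2"
      using q(2) abs_le_square_iff[of 1 "f p"] by simp
    then show "(case q of (p, \<nu>) \<Rightarrow> 1 / real (p ^ \<nu>)) = ?g q" using q(1) by simp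
  qed
  also have "\<dots> \<le> infsum ?g ?T"
  proof (rule finite_sum_le_infsum)
    show "?g summable_on ?T" using \<eta> R unfolding tail_function_def by blast
    show "finite S" using S finite_large_prime_powers finite_subset by blast
    show "S \<subseteq> ?T"
    proof
      fix q assume "q \<in> S"
      then have "q \<in> large_prime_powers f R x k" using S by blast
      then show "q \<in> ?T"
        using large_prime_power_gt[of "fst q" "snd q" f R x k]
        by (auto simp: large_prime_powers_def split: prod.splits)
    qed
  qed auto
  also have "\<dots> \<le> \<eta> R" using \<eta> R unfolding tail_function_def by blast
  finally show ?thesis .
qed

lemma exceptional_bound_ratio_estimate:
  assumes f: "strongly_additive f" and \<eta>: "tail_function f \<eta>" and h: "admissible_fibre h"
    and ratio: "ratio_estimate \<kappa> x0 C h" and C: "0 < C"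
    and x: "0 < x" "x0 \<le> x" and k: "1 \<le> k"
    and r: "0 \<le> r" "r = real k / log2_iter x" "\<kappa> \<le> r" "r \<le> 1 / \<kappa>" and R: "1 < R"
  shows "real (card {n \<in> fibre h x k. truncation R f n \<noteq> f n})
    \<le> C * r * \<eta> R * real (fibre_count h x k)"
proof -
  let ?Q = "large_prime_powers f R x k"
  let ?N = "real (fibre_count h x k)"
  have "real (card {n \<in> fibre h x k. truncation R f n \<noteq> f n})
      \<le> real (\<Sum>(p, \<nu>)\<in>?Q. fibre_count h (x / real (p ^ \<nu>)) (k - 1))"
    using exceptional_count_le[OF f h x(1) k] by (simp only: of_nat_le_iff)
  also have "\<dots> = (\<Sum>(p, \<nu>)\<in>?Q. real (fibre_count h (x / real (p ^ \<nu>)) (k - 1)))"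
    by (simp add: case_prod_unfold)
  also have "\<dots> \<le> (\<Sum>(p, \<nu>)\<in>?Q. (C * r * ?N) * (1 / real (p ^ \<nu>)))"
  proof (intro sum_mono, clarify)
    fix p \<nu> assume q: "(p, \<nu>) \<in> ?Q"
    have "1 < real (p ^ \<nu>)" using large_prime_power_gt[OF q] R by linarith
    then have "2 \<le> p ^ \<nu>" by linarith
    moreover have "real (p ^ \<nu>) \<le> x / 2 ^ (k - 1)"
      using q unfolding large_prime_powers_def by blast
    ultimately have "real (fibre_count h (x / real (p ^ \<nu>)) (k - 1))
        \<le> C * (r / real (p ^ \<nu>)) * ?N"
      using ratio x(2) k r(2-4) unfolding ratio_estimate_def by blast
    then show "real (fibre_count h (x / real (p ^ \<nu>)) (k - 1))
        \<le> C * r * ?N * (1 / real (p ^ \<nu>))"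
      by (simp add: field_simps)
  qed
  also have "\<dots> = (C * r * ?N) * (\<Sum>(p, \<nu>)\<in>?Q. 1 / real (p ^ \<nu>))"
    by (simp add: sum_distrib_left case_prod_unfold)
  also have "\<dots> \<le> (C * r * ?N) * \<eta> R"
    using large_prime_powers_sum_le_tail[OF \<eta> R order_refl, of x k] C r(1)
    by (intro mult_left_mono) auto
  finally show ?thesis by (simp add: mult_ac)
qed

text \<open>
  This covers the bounded range of \<open>x\<close>: one exceptional integer forces \<open>\<eta> R\<close> to be at least
  the reciprocal of a prime up to \<open>x\<close>, so the trivial bound by the whole fibre suffices.
\<close>

lemma exceptional_bound_trivial:
  assumes f: "strongly_additive f" and \<eta>: "tail_function f \<eta>" and R: "1 < R" and x: "0 < x"
  shows "real (card {n \<in> fibre h x k. truncation R f n \<noteq> f n})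
    \<le> x * \<eta> R * real (fibre_count h x k)"
proof (cases "{n \<in> fibre h x k. truncation R f n \<noteq> f n} = {}")
  case True
  have "0 \<le> \<eta> R" using large_prime_powers_sum_le_tail[OF \<eta> R, of "{}"] by simp
  then have "0 \<le> x * \<eta> R * real (fibre_count h x k)" using x by simp
  with True show ?thesis by (simp only: card.empty of_nat_0)
next
  case False
  then obtain n where n: "0 < n" "real n \<le> x" "truncation R f n \<noteq> f n"
    unfolding fibre_def by auto
  obtain p where p: "prime p" "p dvd n" "R < real p" "1 < \<bar>f p\<bar>"
    using truncation_neq_imp_large_prime[OF f n(1,3)] .
  have px: "real p \<le> x"
    using dvd_imp_le[OF p(2) n(1)] n(2) by (meson of_nat_le_iff order_trans)
  \<comment> \<open>The level 1 makes the size restriction in \<open>large_prime_powers\<close> read \<open>p \<le> x\<close>.\<close>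
  have "{(p, 1)} \<subseteq> large_prime_powers f R x 1"
    using p px unfolding large_prime_powers_def by simp
  from large_prime_powers_sum_le_tail[OF \<eta> R this] have "1 / real p \<le> \<eta> R" by simp
  moreover have "1 / x \<le> 1 / real p"
    using px prime_gt_0_nat[OF p(1)] x by (intro divide_left_mono) auto
  ultimately have "1 / x \<le> \<eta> R" by linarith
  then have one: "1 \<le> x * \<eta> R" using x by (simp add: field_simps)
  have "real (card {n \<in> fibre h x k. truncation R f n \<noteq> f n}) \<le> 1 * real (fibre_count h x k)"
    unfolding fibre_count_def by (simp add: card_mono finite_fibre)
  also have "\<dots> \<le> x * \<eta> R * real (fibre_count h x k)"
    using one by (intro mult_right_mono) auto
  finally show ?thesis .
qed

theorem theorem1p3:
  fixes \<kappa> x0 C :: real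
  assumes "0 < \<kappa>" and "\<kappa> < 1" and "3 \<le> x0" and "0 < C"
  shows "\<exists>C\<kappa>>0. \<forall>(f :: nat \<Rightarrow> real) (\<eta> :: real \<Rightarrow> real) (h :: nat \<Rightarrow> nat).
    strongly_additive f \<longrightarrow>
    (\<lambda>p. min 1 ((f p)\<^sup>2) / real p) summable_on {p. prime p} \<longrightarrow>
    summable (\<lambda>p. if prime p \<and> \<bar>f p\<bar> \<le> 1 then f p / real p else 0) \<longrightarrow>
    \<not> (\<lambda>p. 1 / real p) summable_on {p. prime p \<and> f p \<noteq> 0} \<longrightarrow>
    tail_function f \<eta> \<longrightarrow>
    admissible_fibre h \<longrightarrow>
    ratio_estimate \<kappa> x0 C h \<longrightarrow>
    (\<forall>(x :: real) (k :: nat) (R :: real).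
       3 \<le> x \<longrightarrow> 1 \<le> k \<longrightarrow>
       \<kappa> \<le> real k / log2_iter x \<longrightarrow> real k / log2_iter x \<le> 1 / \<kappa> \<longrightarrow>
       3 \<le> R \<longrightarrow> R \<le> x \<longrightarrow>
       real (card {n \<in> fibre h x k. truncation R f n \<noteq> f n})
         \<le> C\<kappa> * (real k / log2_iter x) * \<eta> R * real (fibre_count h x k))"
proof (intro exI[of _ "C + x0 / \<kappa>"] conjI allI impI)
  show "0 < C + x0 / \<kappa>" using assms by (simp add: add_pos_pos)
next
  fix f \<eta> h x k R
  assume f: "strongly_additive f" and \<eta>: "tail_function f \<eta>" and h: "admissible_fibre h"
    and ratio: "ratio_estimate \<kappa> x0 C h"
    and x: "3 \<le> x" and k: "1 \<le> k"
    and r1: "\<kappa> \<le> real k / log2_iter x" and r2: "real k / log2_iter x \<le> 1 / \<kappa>"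
    and R: "3 \<le> R" "R \<le> x"
  let ?E = "real (card {n \<in> fibre h x k. truncation R f n \<noteq> f n})"
  let ?N = "real (fibre_count h x k)"
  define r where "r = real k / log2_iter x"
  have R1: "1 < R" and x0: "0 < x" using R x by auto
  have r: "\<kappa> \<le> r" "r \<le> 1 / \<kappa>" "0 \<le> r" using r1 r2 assms(1) by (auto simp: r_def)
  have "0 \<le> \<eta> R" using large_prime_powers_sum_le_tail[OF \<eta> R1, of "{}"] by simp
  then have nonneg: "0 \<le> \<eta> R * ?N" by simp
  have "?E \<le> (C + x0 / \<kappa>) * r * (\<eta> R * ?N)"
  proof (cases "x0 \<le> x")
    case True
    have "?E \<le> C * r * (\<eta> R * ?N)"
      using exceptional_bound_ratio_estimate[OF f \<eta> h ratio assms(4) x0 True k r(3) r_def r(1,2) R1]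
      by (simp add: mult.assoc)
    also have "\<dots> \<le> (C + x0 / \<kappa>) * r * (\<eta> R * ?N)"
      using assms r(3) nonneg by (intro mult_right_mono) auto
    finally show ?thesis .
  next
    case False
    have "?E \<le> x * (\<eta> R * ?N)"
      using exceptional_bound_trivial[OF f \<eta> R1 x0] by (simp add: mult.assoc)
    also have "\<dots> \<le> (C + x0 / \<kappa>) * r * (\<eta> R * ?N)"
    proof (rule mult_right_mono[OF _ nonneg])
      have "x \<le> x0 / \<kappa> * \<kappa>" using False assms(1) by simp
      also have "\<dots> \<le> (C + x0 / \<kappa>) * r"
        using assms r(1) by (intro mult_mono) auto
      finally show "x \<le> (C + x0 / \<kappa>) * r" .
    qed
    finally show ?thesis .
  qed
  then show "?E \<le> (C + x0 / \<kappa>) * (real k / log2_iter x) * \<eta> R * ?N"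
    by (simp add: r_def mult.assoc)
qed

end
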